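(* Let $K=\mathbb{F}_q$ be a finite field, let $v_1,\ldots,v_n$ be positive integers, and let $X\subset\mathbb{P}^{n-1}$ be the degenerate projective torus parameterized by $x_1^{v_1},\ldots,x_n^{v_n}$, with vanishing ideal $I(X)\subset S=K[t_1,\ldots,t_n]$. Let $\beta$ be a generator of the cyclic group $K^*$, let $d_i$ be the order of $\beta^{v_i}$ in $K^*$, let $P\subset S$ be the toric ideal of $K[y_1^{d_1},\ldots,y_1^{d_n}]$, and let $D\colon\mathbb{Z}^n\to\mathbb{Z}^n$ be the homomorphism with $D(e_i)=d_ie_i$. Let $a_1,\ldots,a_m,b_1,\ldots,b_m\in\mathbb{N}^n$. If $P=(\{t^{a_i}-t^{b_i}\}_{i=1}^m)$, then $I(X)=(\{t^{D(a_i)}-t^{D(b_i)}\}_{i=1}^m)$.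
   Context: $X=\{[(x_1^{v_1},\ldots,x_n^{v_n})] : x_i\in K^*\text{ for all }i\}\subset\mathbb{P}^{n-1}$, where $\mathbb{P}^{n-1}$ is the projective space over $K$ and $K^*=K\setminus\{0\}$. $S=K[t_1,\ldots,t_n]$ has the standard grading, and $I(X)$ is the ideal of $S$ generated by the homogeneous polynomials that vanish at all points of $X$. The toric ideal $P$ is the kernel of the $K$-algebra epimorphism $S\to K[y_1^{d_1},\ldots,y_1^{d_n}]\subset K[y_1]$, $t_i\mapsto y_1^{d_i}$, where $K[y_1]$ is a polynomial ring in one variable. $e_1,\ldots,e_n$ is the canonical basis of $\mathbb{Z}^n$. For $a=(a_{1},\ldots,a_{n})\in\mathbb{N}^n$, $t^a=t_1^{a_1}\cdots t_n^{a_n}$. *)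

theory Defs
  imports
    "HOL-Library.Poly_Mapping"
    "HOL-Computational_Algebra.Polynomial"
    "HOL-Algebra.Elementary_Groups"
    "HOL-Algebra.Multiplicative_Group"
    "HOL-Analysis.Finite_Cartesian_Product"
begin

text \<open>The variables \<open>t\<^sub>1, \<dots>, t\<^sub>n\<close> are indexed by a finite type \<open>'n\<close>, with \<open>n = CARD('n) \<ge> 1\<close>.
  An exponent vector is an element of \<open>'n \<Rightarrow>\<^sub>0 nat\<close>, and a polynomial maps exponent vectors to
  coefficients, with the convolution product of \<^theory>\<open>HOL-Library.Poly_Mapping\<close>.\<close>

type_synonym ('n, 'k) mpoly = "('n \<Rightarrow>\<^sub>0 nat) \<Rightarrow>\<^sub>0 'k"

definition tmon :: "('n \<Rightarrow>\<^sub>0 nat) \<Rightarrow> ('n, 'k::comm_ring_1) mpoly" where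
  "tmon a = Poly_Mapping.single a 1"

text \<open>Extension of a coefficient map \<open>\<phi>\<close> along the substitution \<open>t\<^sub>i \<mapsto> g i\<close>; if \<open>\<phi>\<close> is a ring
  homomorphism, then this is the unique ring homomorphism that extends it.\<close>

definition substitute ::
    "('k::comm_ring_1 \<Rightarrow> 'r::comm_ring_1) \<Rightarrow> ('n::finite \<Rightarrow> 'r) \<Rightarrow> ('n, 'k) mpoly \<Rightarrow> 'r" where
  "substitute \<phi> g p =
     (\<Sum>m\<in>Poly_Mapping.keys p.
        \<phi> (Poly_Mapping.lookup p m) * (\<Prod>i\<in>UNIV. g i ^ Poly_Mapping.lookup m i))"

definition eval_at :: "('n::finite, 'k::comm_ring_1) mpoly \<Rightarrow> 'k ^ 'n \<Rightarrow> 'k" where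
  "eval_at p x = substitute (\<lambda>c. c) (\<lambda>i. x $ i) p"

definition homogeneous :: "('n::finite, 'k::zero) mpoly \<Rightarrow> bool" where
  "homogeneous p \<longleftrightarrow>
     (\<exists>d. \<forall>m\<in>Poly_Mapping.keys p. (\<Sum>i\<in>UNIV. Poly_Mapping.lookup m i) = d)"

text \<open>An ideal of a commutative ring is a submodule of the ring over itself.\<close>

definition ideal_gen :: "'r::comm_ring_1 set \<Rightarrow> 'r set" where
  "ideal_gen B = module.span (*) B"

text \<open>The homomorphism is taken with codomain the whole of \<open>K[y\<^sub>1]\<close> rather than its image
  \<open>K[y\<^sub>1^d\<^sub>1, \<dots>, y\<^sub>1^d\<^sub>n]\<close>; the kernel is the same.\<close>

definition toric_ideal :: "('n::finite \<Rightarrow> nat) \<Rightarrow> ('n, 'k::field) mpoly set" where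
  "toric_ideal d = {p. substitute (\<lambda>c. [:c:]) (\<lambda>i. Polynomial.monom 1 (d i)) p = 0}"

text \<open>A point of projective space is the set of all its homogeneous coordinate vectors.\<close>

definition proj_rel :: "('k::field ^ 'n) rel" where
  "proj_rel = {(x, y). x \<noteq> 0 \<and> y \<noteq> 0 \<and> (\<exists>c. c \<noteq> 0 \<and> y = c *s x)}"

definition proj_space :: "('k::field ^ 'n) set set" where
  "proj_space = (UNIV - {0}) // proj_rel"

definition proj_point :: "'k::field ^ 'n \<Rightarrow> ('k ^ 'n) set" where
  "proj_point x = proj_rel `` {x}"

definition degenerate_torus :: "('n::finite \<Rightarrow> nat) \<Rightarrow> ('k::field ^ 'n) set set" where
  "degenerate_torus v = {proj_point (\<chi> i. x i ^ v i) | x. \<forall>i. x i \<noteq> 0}"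

lemma degenerate_torus_subset: "degenerate_torus v \<subseteq> proj_space"
  unfolding degenerate_torus_def proj_space_def proj_point_def
  by (auto intro!: quotientI simp: vec_eq_iff)

definition vanishing_ideal :: "('k::field ^ 'n::finite) set set \<Rightarrow> ('n, 'k) mpoly set" where
  "vanishing_ideal X =
     ideal_gen {f. homogeneous f \<and> (\<forall>Q\<in>X. \<forall>x\<in>Q. eval_at f x = 0)}"

definition unit_group :: "'k::field monoid" where
  "unit_group = \<lparr>carrier = UNIV - {0}, monoid.mult = (*), one = 1\<rparr>"

text \<open>The passage between \<open>\<nat>\<^sup>n\<close> and \<open>\<int>\<^sup>n\<close>. The second map is only meaningful on vectors with
  nonnegative entries; it sends negative entries to \<open>0\<close>.\<close>

definition int_vec :: "('n \<Rightarrow>\<^sub>0 nat) \<Rightarrow> ('n \<Rightarrow>\<^sub>0 int)" where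
  "int_vec a = Poly_Mapping.map int a"

definition nat_vec :: "('n \<Rightarrow>\<^sub>0 int) \<Rightarrow> ('n \<Rightarrow>\<^sub>0 nat)" where
  "nat_vec a = Poly_Mapping.map nat a"

end

theory Submission
  imports Defs
begin

text \<open>Let \<open>J\<close> be the ideal generated by the binomials with exponents \<open>D(a\<^sub>i)\<close> and \<open>D(b\<^sub>i)\<close>; it contains the image of \<open>P\<close> under
  \<open>t\<^sub>i \<mapsto> t\<^sub>i^d\<^sub>i\<close>. Evaluated at the points \<open>(x\<^sub>i^v\<^sub>i)\<^sub>i\<close>, each monomial is a character. If a homogeneous \<open>f\<close>
  vanishes on \<open>X\<close>, independence of characters shows that the coefficients of the monomials of \<open>f\<close>
  inducing the same character add up to \<open>0\<close>, so it suffices that two such monomials are congruent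
  modulo \<open>J\<close>. Their exponents agree modulo the \<open>d\<^sub>i\<close>, so they are \<open>r + D \<alpha>\<close> and \<open>r + D \<alpha>'\<close> with a common
  \<open>r\<close>; having equal degrees, they satisfy \<open>\<Sum> d\<^sub>i \<alpha>\<^sub>i = \<Sum> d\<^sub>i \<alpha>'\<^sub>i\<close>, that is, the binomial of \<open>\<alpha>\<close> and
  \<open>\<alpha>'\<close> lies in \<open>P\<close>.\<close>

section \<open>Generated ideals\<close>

text \<open>Not an interpretation: the simp rule \<open>scale_scale\<close> would then undo \<open>mult.assoc\<close>.\<close>

lemma module_mult: "Modules.module ((*) :: 'r::comm_ring_1 \<Rightarrow> 'r \<Rightarrow> 'r)"
  by unfold_locales (simp_all add: algebra_simps)

lemmas ideal_gen_base = Modules.module.span_base[OF module_mult, folded ideal_gen_def]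
  and ideal_gen_zero = Modules.module.span_zero[OF module_mult, folded ideal_gen_def]
  and ideal_gen_add = Modules.module.span_add[OF module_mult, folded ideal_gen_def]
  and ideal_gen_mult = Modules.module.span_scale[OF module_mult, folded ideal_gen_def]
  and ideal_gen_sum = Modules.module.span_sum[OF module_mult, folded ideal_gen_def]
  and ideal_gen_induct [consumes 1, case_names base step] =
    Modules.module.span_induct_alt[OF module_mult, folded ideal_gen_def]

lemma ideal_gen_subset:
  assumes "A \<subseteq> ideal_gen B"
  shows "ideal_gen A \<subseteq> ideal_gen B"
  using assms unfolding ideal_gen_def
  by (intro Modules.module.span_minimal[OF module_mult] Modules.module.subspace_span[OF module_mult])

section \<open>Substitution homomorphisms\<close>

lemma poly_mapping_eq_sum_single:
  "p = (\<Sum>m\<in>Poly_Mapping.keys p. Poly_Mapping.single m (Poly_Mapping.lookup p m))"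
  by (rule poly_mapping_eqI) (auto simp: lookup_sum lookup_single when_def in_keys_iff)

lemma substitute_single:
  assumes "additive \<phi>"
  shows "substitute \<phi> g (Poly_Mapping.single m c) =
    \<phi> c * (\<Prod>i\<in>UNIV. g i ^ Poly_Mapping.lookup m i)"
  using additive.zero[OF assms] by (cases "c = 0") (simp_all add: substitute_def)

lemma additive_substitute:
  assumes "additive \<phi>"
  shows "additive (substitute \<phi> g)"
  unfolding additive_def substitute_def
  \<comment> \<open>Cancellation may shrink the keys of a sum; this is harmless, since a summand
    with coefficient 0 is 0.\<close>
  by (intro allI setsum_keys_plus_distrib)
    (simp_all add: additive.zero[OF assms] additive.add[OF assms] algebra_simps)

lemma substitute_mult:
  assumes add: "additive \<phi>" and mult: "\<And>x y. \<phi> (x * y) = \<phi> x * \<phi> y"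
  shows "substitute \<phi> g (p * q) = substitute \<phi> g p * substitute \<phi> g q"
proof -
  note S = additive.sum[OF additive_substitute[OF add]]
  have single: "substitute \<phi> g (Poly_Mapping.single k c * Poly_Mapping.single l e) =
      substitute \<phi> g (Poly_Mapping.single k c) * substitute \<phi> g (Poly_Mapping.single l e)" for k l c e
    by (simp add: mult_single substitute_single[OF add] mult lookup_add power_add prod.distrib ac_simps)
  \<comment> \<open>Stated for arbitrary families, so that the decompositions of \<open>p\<close>
    and \<open>q\<close> are only rewritten from right to left; expanding with them would
    loop.\<close>
  have "substitute \<phi> g ((\<Sum>k\<in>A. Poly_Mapping.single k (c k)) * (\<Sum>l\<in>B. Poly_Mapping.single l (e l))) =
      substitute \<phi> g (\<Sum>k\<in>A. Poly_Mapping.single k (c k)) * substitute \<phi> g (\<Sum>l\<in>B. Poly_Mapping.single l (e l))"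
    for A B c e
    by (simp only: sum_product S single)
  from this[of "Poly_Mapping.lookup p" "Poly_Mapping.keys p" "Poly_Mapping.lookup q" "Poly_Mapping.keys q"]
  show ?thesis
    by (simp only: flip: poly_mapping_eq_sum_single)
qed

lemma additive_single: "additive (Poly_Mapping.single k)"
  by (simp add: additive_def single_add)

text \<open>Gives the image of a monomial under t_i -> t_i^(d_i). The exponent \<open>a'\<close> is
  described by its entries, so that D(a) can take its place.\<close>

lemma prod_tmon_power:
  fixes d :: "'n::finite \<Rightarrow> nat"
  assumes "\<And>i. Poly_Mapping.lookup a' i = d i * Poly_Mapping.lookup a i"
  shows "(\<Prod>i\<in>UNIV. tmon (Poly_Mapping.single i (d i)) ^ Poly_Mapping.lookup a i) =
    (tmon a' :: ('n, 'k::comm_ring_1) mpoly)"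
proof -
  have power: "(tmon (Poly_Mapping.single i l) :: ('n, 'k) mpoly) ^ k = tmon (Poly_Mapping.single i (l * k))"
    for i l k
    by (induction k) (simp_all add: tmon_def mult_single flip: single_add)
  have prod: "(\<Prod>i\<in>I. (tmon (h i) :: ('n, 'k) mpoly)) = tmon (\<Sum>i\<in>I. h i)" if "finite I" for h and I :: "'n set"
    using that by induction (simp_all add: tmon_def mult_single)
  have "(\<Sum>i\<in>UNIV. Poly_Mapping.single i (d i * Poly_Mapping.lookup a i)) = a'"
    by (rule poly_mapping_eqI) (simp add: lookup_sum lookup_single when_def assms)
  then show ?thesis
    by (simp add: power prod)
qed

section \<open>Characters and fibres of monomials\<close>

text \<open>Dedekind's argument: subtracting \<open>\<psi> y\<close> times the relation at
  \<open>x\<close> from the relation at \<open>y + x\<close> eliminates \<open>\<psi>\<close>. The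
  domain is additive because the characters will be evaluated at exponent vectors.\<close>

lemma characters_independent:
  fixes C :: "('g::monoid_add \<Rightarrow> 'k::field) set"
  assumes "finite C"
    and one: "\<And>\<eta>. \<eta> \<in> C \<Longrightarrow> \<eta> 0 = 1"
    and mult: "\<And>\<eta> x y. \<eta> \<in> C \<Longrightarrow> \<eta> (x + y) = \<eta> x * \<eta> y"
    and zero: "\<And>x. (\<Sum>\<eta>\<in>C. c \<eta> * \<eta> x) = 0"
    and "\<eta> \<in> C"
  shows "c \<eta> = 0"
  using assms
proof (induction C arbitrary: c \<eta>)
  case empty
  then show ?case by simp
next
  case (insert \<psi> C)
  have diff: "(\<Sum>\<eta>\<in>C. (c \<eta> * (\<eta> y - \<psi> y)) * \<eta> x) = 0" for x y
  proof -
    have "(\<Sum>\<eta>\<in>C. (c \<eta> * (\<eta> y - \<psi> y)) * \<eta> x) =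
        (\<Sum>\<eta>\<in>insert \<psi> C. c \<eta> * (\<eta> y * \<eta> x)) - \<psi> y * (\<Sum>\<eta>\<in>insert \<psi> C. c \<eta> * \<eta> x)"
      using insert.hyps by (simp add: sum_distrib_left sum_subtractf algebra_simps)
    also have "(\<Sum>\<eta>\<in>insert \<psi> C. c \<eta> * (\<eta> y * \<eta> x)) = (\<Sum>\<eta>\<in>insert \<psi> C. c \<eta> * \<eta> (y + x))"
      by (intro sum.cong refl arg_cong2[where f = "(*)"] insert.prems(2)[symmetric])
    finally show ?thesis by (simp only: insert.prems(3)) simp
  qed
  have C: "c \<eta> = 0" if "\<eta> \<in> C" for \<eta>
  proof -
    have "\<eta> \<noteq> \<psi>" using that insert.hyps by auto
    then obtain y where "\<eta> y \<noteq> \<psi> y" by (auto simp: fun_eq_iff)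
    moreover have "c \<eta> * (\<eta> y - \<psi> y) = 0"
    proof (rule insert.IH[where c = "\<lambda>\<eta>. c \<eta> * (\<eta> y - \<psi> y)"])
      show "\<theta> 0 = 1" if "\<theta> \<in> C" for \<theta>
        using insert.prems(1)[of \<theta>] that by simp
      show "\<theta> (x + z) = \<theta> x * \<theta> z" if "\<theta> \<in> C" for \<theta> x z
        using insert.prems(2)[of \<theta>] that by blast
    qed (fact diff that)+
    ultimately show ?thesis by simp
  qed
  \<comment> \<open>At 0 every character is 1 and the other coefficients already vanish, so only
    \<open>c \<psi>\<close> is left of the relation.\<close>
  have "c \<psi> = 0"
    using insert.prems(3)[of 0] insert.prems(1)[of \<psi>] insert.hyps C by simp
  then show ?case using C insert.prems(4) by auto
qed

text \<open>Moving every monomial to a chosen representative of its fibre changes \<open>f\<close>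
  only by an element of the ideal. The result is 0, because the coefficients of each fibre add up on
  its representative.\<close>

lemma mem_ideal_if_fibre_sums_zero:
  fixes f :: "('n, 'k::comm_ring_1) mpoly"
  assumes zero: "\<And>g. g \<in> \<kappa> ` Poly_Mapping.keys f \<Longrightarrow>
      (\<Sum>m | m \<in> Poly_Mapping.keys f \<and> \<kappa> m = g. Poly_Mapping.lookup f m) = 0"
    and diff: "\<And>m m'. \<lbrakk>m \<in> Poly_Mapping.keys f; m' \<in> Poly_Mapping.keys f; \<kappa> m = \<kappa> m'\<rbrakk> \<Longrightarrow>
      tmon m - tmon m' \<in> ideal_gen B"
  shows "f \<in> ideal_gen B"
proof -
  let ?K = "Poly_Mapping.keys f" and ?c = "Poly_Mapping.lookup f"
  obtain \<rho> where \<rho>: "\<rho> (\<kappa> m) \<in> ?K" "\<kappa> (\<rho> (\<kappa> m)) = \<kappa> m" if "m \<in> ?K" for m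
    by (rule that[of "inv_into ?K \<kappa>"]) (auto intro: inv_into_into f_inv_into_f)
  have "(\<Sum>m\<in>?K. Poly_Mapping.single (\<rho> (\<kappa> m)) (?c m)) =
      (\<Sum>g\<in>\<kappa> ` ?K. \<Sum>m | m \<in> ?K \<and> \<kappa> m = g. Poly_Mapping.single (\<rho> (\<kappa> m)) (?c m))"
    by (rule sum.image_gen) simp
  also have "\<dots> = (\<Sum>g\<in>\<kappa> ` ?K. Poly_Mapping.single (\<rho> g) (\<Sum>m | m \<in> ?K \<and> \<kappa> m = g. ?c m))"
    by (intro sum.cong refl) (simp add: additive.sum[OF additive_single])
  also have "\<dots> = 0" by (simp add: zero)
  finally have "f = (\<Sum>m\<in>?K. Poly_Mapping.single m (?c m) - Poly_Mapping.single (\<rho> (\<kappa> m)) (?c m))"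
    by (simp add: sum_subtractf flip: poly_mapping_eq_sum_single)
  also have "\<dots> = (\<Sum>m\<in>?K. Poly_Mapping.single 0 (?c m) * (tmon m - tmon (\<rho> (\<kappa> m))))"
    by (simp add: tmon_def mult_single algebra_simps)
  also have "\<dots> \<in> ideal_gen B"
    by (intro ideal_gen_sum ideal_gen_mult diff) (simp_all add: \<rho>)
  finally show ?thesis .
qed

text \<open>Each monomial goes to the power of y_1 whose exponent is its degree weighted by
  \<open>d\<close>, and powers with different exponents differ.\<close>

lemma tmon_diff_mem_toric_ideal_iff:
  "(tmon a - tmon b :: ('n::finite, 'k::field) mpoly) \<in> toric_ideal d \<longleftrightarrow>
    (\<Sum>i\<in>UNIV. d i * Poly_Mapping.lookup a i) = (\<Sum>i\<in>UNIV. d i * Poly_Mapping.lookup b i)"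
proof -
  have const: "additive (\<lambda>c::'k. [:c:])"
    by (simp add: additive_def)
  have prod: "(\<Prod>i\<in>I. Polynomial.monom 1 (h i)) = (Polynomial.monom 1 (\<Sum>i\<in>I. h i) :: 'k poly)" if "finite I" for I and h :: "'n \<Rightarrow> nat"
    using that by induction (simp_all add: mult_monom)
  show ?thesis
    by (simp add: toric_ideal_def additive.diff[OF additive_substitute[OF const]] tmon_def
        substitute_single[OF const] monom_power prod monom_eq_iff' ac_simps flip: one_pCons)
qed

lemma eval_at_eq_sum:
  "eval_at f x = (\<Sum>m\<in>Poly_Mapping.keys f.
    Poly_Mapping.lookup f m * (\<Prod>i\<in>UNIV. x $ i ^ Poly_Mapping.lookup m i))"
  by (simp add: eval_at_def substitute_def)

lemma eval_at_tmon_diff: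
  "eval_at (tmon a - tmon b) x =
    (\<Prod>i\<in>UNIV. x $ i ^ Poly_Mapping.lookup a i) - (\<Prod>i\<in>UNIV. x $ i ^ Poly_Mapping.lookup b i)"
proof -
  have id: "additive (\<lambda>c::'a. c)" by (simp add: additive_def)
  show ?thesis
    by (simp add: eval_at_def additive.diff[OF additive_substitute[OF id]] tmon_def substitute_single[OF id])
qed

lemma homogeneous_tmon_diff:
  assumes "(\<Sum>i\<in>UNIV. Poly_Mapping.lookup a i) = (\<Sum>i\<in>UNIV. Poly_Mapping.lookup b i)"
  shows "homogeneous (tmon a - tmon b :: ('n::finite, 'k::comm_ring_1) mpoly)"
  unfolding homogeneous_def
proof (intro exI ballI)
  fix m assume "m \<in> Poly_Mapping.keys (tmon a - tmon b :: ('n, 'k) mpoly)"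
  then have "m = a \<or> m = b"
    by (auto simp: in_keys_iff lookup_minus tmon_def lookup_single when_def split: if_splits)
  then show "(\<Sum>i\<in>UNIV. Poly_Mapping.lookup m i) = (\<Sum>i\<in>UNIV. Poly_Mapping.lookup a i)"
    using assms by auto
qed

section \<open>The multiplicative group of the field\<close>

lemma group_unit_group: "group (unit_group :: 'k::field monoid)"
  by (rule groupI) (auto simp: unit_group_def intro!: bexI[of _ "inverse _"])

lemma carrier_unit_group: "x \<in> carrier unit_group \<longleftrightarrow> x \<noteq> 0"
  by (simp add: unit_group_def)

lemma unit_group_pow: "x [^]\<^bsub>unit_group\<^esub> (n::nat) = x ^ n"
  by (induction n) (simp_all add: unit_group_def nat_pow_def mult.commute)

lemma power_eq_1_iff_ord_dvd:
  fixes x :: "'k::field"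
  assumes "x \<noteq> 0"
  shows "x ^ n = 1 \<longleftrightarrow> group.ord unit_group x dvd n"
  using group.pow_eq_id[OF group_unit_group, of x n] assms
  by (simp add: unit_group_pow) (simp add: unit_group_def)

text \<open>Cancelling the smaller power leaves a power equal to 1. For \<open>x\<close> of infinite
  order, \<open>ord\<close> is 0 and the congruence is equality.\<close>

lemma power_eq_imp_mod_ord_eq:
  fixes x :: "'k::field"
  assumes "x \<noteq> 0" and "x ^ m = x ^ n"
  shows "m mod group.ord unit_group x = n mod group.ord unit_group x"
  using assms(2)
proof (induction m n rule: linorder_wlog)
  case (le m n)
  then have "x ^ m * x ^ (n - m) = x ^ m * 1"
    by (metis le_add_diff_inverse mult_1_right power_add)
  then have "group.ord unit_group x dvd n - m"
    using assms(1) by (simp add: power_eq_1_iff_ord_dvd)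
  with le show ?case
    by (metis mod_eq_dvd_iff_nat)
qed simp

text \<open>In a finite group inverses are natural powers too, so exponents can stay in
  \<nat>.\<close>

lemma generator_power:
  fixes \<beta> x :: "'k::{field, finite}"
  assumes "subgroup_generated unit_group {\<beta>} = unit_group" and "\<beta> \<noteq> 0" and "x \<noteq> 0"
  obtains k where "x = \<beta> ^ k"
proof -
  have "generate unit_group {\<beta>} = carrier unit_group"
    using arg_cong[OF assms(1), of carrier] assms(2)
    by (simp add: carrier_subgroup_generated carrier_unit_group)
  then have "x \<in> {\<beta> [^]\<^bsub>unit_group\<^esub> k | k. k \<in> (UNIV :: nat set)}"
    using group.generate_pow_on_finite_carrier[OF group_unit_group, of \<beta>] assms(2,3)
    by (simp add: carrier_unit_group)
  then show ?thesis using that by (auto simp: unit_group_pow)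
qed

text \<open>Expanding \<open>a\<close> in the canonical basis makes D(a) explicit; its entries are
  nonnegative, so \<open>nat_vec\<close> truncates nothing.\<close>

lemma lookup_diagonal:
  fixes D :: "('n::finite \<Rightarrow>\<^sub>0 int) \<Rightarrow> ('n \<Rightarrow>\<^sub>0 int)"
  assumes "additive D"
    and D: "\<forall>i. D (Poly_Mapping.single i 1) = Poly_Mapping.single i (int (d i))"
  shows "Poly_Mapping.lookup (nat_vec (D (int_vec a))) i = d i * Poly_Mapping.lookup a i"
proof -
  have single: "D (Poly_Mapping.single i (int k)) = Poly_Mapping.single i (int (d i * k))" for i k
  proof (induction k)
    case 0
    then show ?case by (simp add: additive.zero[OF assms(1)])
  next
    case (Suc k)
    then show ?case
      by (simp add: single_add additive.add[OF assms(1)] D distrib_left add.commute)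
  qed
  have lookup_int: "Poly_Mapping.lookup (int_vec a) j = int (Poly_Mapping.lookup a j)" for j
    by (simp add: int_vec_def Poly_Mapping.map.rep_eq when_def)
  have "int_vec a = (\<Sum>j\<in>UNIV. Poly_Mapping.single j (int (Poly_Mapping.lookup a j)))"
    by (rule poly_mapping_eqI) (simp add: lookup_sum lookup_single when_def lookup_int)
  then have "D (int_vec a) = (\<Sum>j\<in>UNIV. Poly_Mapping.single j (int (d j * Poly_Mapping.lookup a j)))"
    by (simp add: additive.sum[OF assms(1)] single del: of_nat_mult)
  then have "Poly_Mapping.lookup (D (int_vec a)) i = int (d i * Poly_Mapping.lookup a i)"
    by (simp add: lookup_sum lookup_single when_def del: of_nat_mult)
  then show ?thesis
    by (simp add: nat_vec_def Poly_Mapping.map.rep_eq when_def del: of_nat_mult)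
qed

section \<open>The vanishing ideal\<close>

text \<open>Exponents divisible by \<open>d i\<close> turn the coordinates \<open>y i ^ v i\<close>
  into 1, so at a point of X each monomial reduces to a power of the scalar relating two coordinate
  vectors of the point. Membership in P makes the two total degrees, hence these powers,
  equal.\<close>

lemma tmon_diff_mem_vanishing_ideal:
  fixes d v :: "'n::finite \<Rightarrow> nat"
  assumes a': "\<And>i. Poly_Mapping.lookup a' i = d i * Poly_Mapping.lookup a i"
    and b': "\<And>i. Poly_Mapping.lookup b' i = d i * Poly_Mapping.lookup b i"
    and root: "\<And>i y. y \<noteq> 0 \<Longrightarrow> (y ^ v i) ^ d i = (1::'k::field)"
    and toric: "(tmon a - tmon b :: ('n, 'k) mpoly) \<in> toric_ideal d"
  shows "tmon a' - tmon b' \<in> vanishing_ideal (degenerate_torus v :: ('k ^ 'n) set set)"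
proof -
  have deg: "(\<Sum>i\<in>UNIV. Poly_Mapping.lookup a' i) = (\<Sum>i\<in>UNIV. Poly_Mapping.lookup b' i)"
    using toric by (simp add: tmon_diff_mem_toric_ideal_iff a' b')
  have "eval_at (tmon a' - tmon b') z = (0::'k)"
    if z: "z \<in> proj_point (\<chi> i. y i ^ v i)" and y: "\<forall>i. y i \<noteq> 0" for z and y :: "'n \<Rightarrow> 'k"
  proof -
    obtain c where c: "z = c *s (\<chi> i. y i ^ v i)"
      using z by (auto simp: proj_point_def proj_rel_def)
    have eval: "(\<Prod>i\<in>UNIV. z $ i ^ Poly_Mapping.lookup e' i) = c ^ (\<Sum>i\<in>UNIV. Poly_Mapping.lookup e' i)"
      if "\<And>i. Poly_Mapping.lookup e' i = d i * Poly_Mapping.lookup e i" for e' e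
    proof -
      have "(y i ^ v i) ^ Poly_Mapping.lookup e' i = 1" for i
        by (simp only: that power_mult root[OF y[rule_format]] power_one)
      then show ?thesis
        by (simp add: c power_mult_distrib power_sum prod.distrib)
    qed
    show ?thesis
      by (simp only: eval_at_tmon_diff eval[OF a'] eval[OF b'] deg) simp
  qed
  then show ?thesis
    unfolding vanishing_ideal_def
    by (intro ideal_gen_base CollectI conjI homogeneous_tmon_diff deg)
      (auto simp: degenerate_torus_def)
qed

text \<open>\<open>\<kappa> m\<close> sends \<open>k\<close> to the value of the monomial
  \<open>m\<close> at the point with parameters x_i = \<beta>^(k_i). Vanishing of \<open>f\<close>
  on X is thus a linear relation among the distinct characters, with the fibre sums as
  coefficients.\<close>

lemma fibre_sums_zero:
  fixes f :: "('n::finite, 'k::field) mpoly" and v :: "'n \<Rightarrow> nat" and \<beta> :: 'k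
  defines "\<kappa> \<equiv> \<lambda>m (k::'n \<Rightarrow>\<^sub>0 nat). \<Prod>i\<in>UNIV. ((\<beta> ^ Poly_Mapping.lookup k i) ^ v i) ^ Poly_Mapping.lookup m i"
  assumes "\<beta> \<noteq> 0"
    and vanish: "\<forall>Q\<in>degenerate_torus v. \<forall>x\<in>Q. eval_at f x = 0"
    and g: "g \<in> \<kappa> ` Poly_Mapping.keys f"
  shows "(\<Sum>m | m \<in> Poly_Mapping.keys f \<and> \<kappa> m = g. Poly_Mapping.lookup f m) = 0"
proof -
  let ?K = "Poly_Mapping.keys f" and ?c = "Poly_Mapping.lookup f"
  have eval: "(\<Sum>m\<in>?K. ?c m * \<kappa> m k) = 0" for k
  proof -
    let ?x = "\<chi> i. (\<beta> ^ Poly_Mapping.lookup k i) ^ v i"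
    have "proj_point ?x \<in> degenerate_torus v"
      unfolding degenerate_torus_def using \<open>\<beta> \<noteq> 0\<close>
      by (intro CollectI exI[of _ "\<lambda>i. \<beta> ^ Poly_Mapping.lookup k i"]) simp
    moreover have "?x \<in> proj_point ?x"
      using \<open>\<beta> \<noteq> 0\<close> by (auto simp: proj_point_def proj_rel_def vec_eq_iff[where y = 0] intro!: exI[of _ 1])
    ultimately have "eval_at f ?x = 0" using vanish by blast
    then show ?thesis by (simp add: eval_at_eq_sum \<kappa>_def)
  qed
  show ?thesis
  proof (rule characters_independent[of "\<kappa> ` ?K" "\<lambda>g. \<Sum>m | m \<in> ?K \<and> \<kappa> m = g. ?c m"])
    show "(\<Sum>g\<in>\<kappa> ` ?K. (\<Sum>m | m \<in> ?K \<and> \<kappa> m = g. ?c m) * g k) = 0" for k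
    proof -
      have "(\<Sum>g\<in>\<kappa> ` ?K. (\<Sum>m | m \<in> ?K \<and> \<kappa> m = g. ?c m) * g k) =
          (\<Sum>g\<in>\<kappa> ` ?K. \<Sum>m | m \<in> ?K \<and> \<kappa> m = g. ?c m * \<kappa> m k)"
        by (auto simp: sum_distrib_right intro!: sum.cong)
      also have "\<dots> = (\<Sum>m\<in>?K. ?c m * \<kappa> m k)"
        by (rule sum.image_gen[symmetric]) simp
      finally show ?thesis by (simp add: eval)
    qed
  qed (use g in \<open>auto simp: \<kappa>_def lookup_add power_add power_mult_distrib prod.distrib\<close>)
qed

theorem proposition3p3:
  fixes v d :: "'n::finite \<Rightarrow> nat"
    and \<beta> :: "'k::{field, finite}"
    and D :: "('n \<Rightarrow>\<^sub>0 int) \<Rightarrow> ('n \<Rightarrow>\<^sub>0 int)"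
    and m :: nat
    and a b :: "nat \<Rightarrow> ('n \<Rightarrow>\<^sub>0 nat)"
  assumes "\<forall>i. v i > 0"
    and "\<beta> \<in> carrier unit_group"
    and "subgroup_generated unit_group {\<beta>} = unit_group"
    and "\<forall>i. d i = group.ord unit_group (\<beta> ^ v i)"
    and "additive D"
    and "\<forall>i. D (Poly_Mapping.single i 1) = Poly_Mapping.single i (int (d i))"
    and "(toric_ideal d :: ('n, 'k) mpoly set) = ideal_gen {tmon (a i) - tmon (b i) | i. i \<in> {1..m}}"
  shows "vanishing_ideal (degenerate_torus v :: ('k ^ 'n) set set) =
    ideal_gen {tmon (nat_vec (D (int_vec (a i)))) - tmon (nat_vec (D (int_vec (b i)))) | i. i \<in> {1..m}}"
proof -
  define E where "E = (\<lambda>a. nat_vec (D (int_vec a)))"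
  define G where "G = {tmon (a i) - tmon (b i) :: ('n, 'k) mpoly | i. i \<in> {1..m}}"
  define H where "H = {tmon (E (a i)) - tmon (E (b i)) :: ('n, 'k) mpoly | i. i \<in> {1..m}}"
  have E: "Poly_Mapping.lookup (E a) i = d i * Poly_Mapping.lookup a i" for a i
    unfolding E_def by (rule lookup_diagonal[OF assms(5,6)])
  have toric: "toric_ideal d = ideal_gen G"
    using assms(7) by (simp add: G_def)
  have "\<beta> \<noteq> 0"
    using assms(2) by (simp add: carrier_unit_group)
  \<comment> \<open>The order of \<beta>^(v_i) serves as an exponent for all v_i-th powers, since
    every unit is a power of \<beta>.\<close>
  have root: "(y ^ v i) ^ d i = 1" if y: "y \<noteq> 0" for y :: 'k and i
  proof -
    obtain k where "y = \<beta> ^ k" using generator_power[OF assms(3) \<open>\<beta> \<noteq> 0\<close> y] .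
    moreover have "(\<beta> ^ v i) ^ d i = 1"
      using \<open>\<beta> \<noteq> 0\<close> assms(4) by (simp add: power_eq_1_iff_ord_dvd)
    ultimately show ?thesis
      by (metis power_mult mult.commute power_one)
  qed
  have image: "tmon (E p) - tmon (E q) \<in> ideal_gen H"
    if "(tmon p - tmon q :: ('n, 'k) mpoly) \<in> toric_ideal d" for p q
  proof -
    let ?\<phi> = "\<lambda>c::'k. Poly_Mapping.single (0 :: 'n \<Rightarrow>\<^sub>0 nat) c"
    let ?\<Phi> = "substitute ?\<phi> (\<lambda>i. tmon (Poly_Mapping.single i (d i)))"
    note add = additive_substitute[OF additive_single]
    have tmon: "?\<Phi> (tmon a) = tmon (E a)" for a
    proof -
      have "?\<Phi> (tmon a) = (\<Prod>i\<in>UNIV. tmon (Poly_Mapping.single i (d i)) ^ Poly_Mapping.lookup a i)"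
        by (simp add: tmon_def substitute_single[OF additive_single])
      then show ?thesis by (simp add: prod_tmon_power[OF E])
    qed
    \<comment> \<open>\<open>?\<Phi>\<close> is the endomorphism t_i -> t_i^(d_i). It carries the
      generators \<open>G\<close> of P into \<open>H\<close>, and multiplicativity takes care of the
      multipliers.\<close>
    have "?\<Phi> u \<in> ideal_gen H" if "u \<in> ideal_gen G" for u
      using that
    proof (induction rule: ideal_gen_induct)
      case base
      then show ?case by (simp add: additive.zero[OF add] ideal_gen_zero)
    next
      case (step c x y)
      then have "?\<Phi> x \<in> H" by (auto simp: G_def H_def additive.diff[OF add] tmon)
      moreover have "?\<Phi> (c * x + y) = ?\<Phi> c * ?\<Phi> x + ?\<Phi> y"
        by (simp add: additive.add[OF add] substitute_mult[OF additive_single] mult_single)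
      ultimately show ?case
        using step by (simp add: ideal_gen_add ideal_gen_mult ideal_gen_base)
    qed
    from this[of "tmon p - tmon q"] that show ?thesis
      by (simp add: toric additive.diff[OF add] tmon)
  qed
  have "vanishing_ideal (degenerate_torus v :: ('k ^ 'n) set set) \<subseteq> ideal_gen H"
    unfolding vanishing_ideal_def
  proof (rule ideal_gen_subset)
    show "{f. homogeneous f \<and> (\<forall>Q\<in>degenerate_torus v. \<forall>x\<in>Q. eval_at f x = 0)} \<subseteq> ideal_gen H"
    proof clarify
      fix f :: "('n, 'k) mpoly"
      assume "homogeneous f" and vanish: "\<forall>Q\<in>degenerate_torus v. \<forall>x\<in>Q. eval_at f x = 0"
      then obtain e where e: "\<And>m. m \<in> Poly_Mapping.keys f \<Longrightarrow> (\<Sum>i\<in>UNIV. Poly_Mapping.lookup m i) = e"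
        by (auto simp: homogeneous_def)
      show "f \<in> ideal_gen H"
      proof (rule mem_ideal_if_fibre_sums_zero[OF fibre_sums_zero[OF \<open>\<beta> \<noteq> 0\<close> vanish]])
        fix p q
        assume keys: "p \<in> Poly_Mapping.keys f" "q \<in> Poly_Mapping.keys f"
          and eq: "(\<lambda>k::'n \<Rightarrow>\<^sub>0 nat. \<Prod>i\<in>UNIV. ((\<beta> ^ Poly_Mapping.lookup k i) ^ v i) ^ Poly_Mapping.lookup p i) =
            (\<lambda>k. \<Prod>i\<in>UNIV. ((\<beta> ^ Poly_Mapping.lookup k i) ^ v i) ^ Poly_Mapping.lookup q i)"
        \<comment> \<open>Coordinatewise division by the \<open>d i\<close>: the remainders will be
          the common factor of the two monomials, the quotients the exponents of a binomial in
          P.\<close>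
        define quo where "quo = (\<lambda>u. \<Sum>i\<in>UNIV. Poly_Mapping.single i (Poly_Mapping.lookup u i div d i))"
        define rem where "rem = (\<lambda>u. \<Sum>i\<in>UNIV. Poly_Mapping.single i (Poly_Mapping.lookup u i mod d i))"
        have quo: "Poly_Mapping.lookup (quo u) i = Poly_Mapping.lookup u i div d i"
          and rem: "Poly_Mapping.lookup (rem u) i = Poly_Mapping.lookup u i mod d i" for u i
          by (simp_all add: quo_def rem_def lookup_sum lookup_single when_def)
        have split: "u = rem u + E (quo u)" for u
          by (rule poly_mapping_eqI) (simp add: lookup_add rem E quo)
        have "Poly_Mapping.lookup p j mod d j = Poly_Mapping.lookup q j mod d j" for j
        proof -
          \<comment> \<open>The unit vector at \<open>j\<close> sets the parameter x_j to \<beta>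
            and all others to 1, which isolates the exponent of t_j.\<close>
          have single: "(\<Prod>i\<in>UNIV. ((\<beta> ^ Poly_Mapping.lookup (Poly_Mapping.single j 1) i) ^ v i) ^ Poly_Mapping.lookup u i) =
              (\<beta> ^ v j) ^ Poly_Mapping.lookup u j" for u
            by (subst prod.remove[of _ j]) (auto simp: lookup_single when_def intro!: prod.neutral)
          have "(\<beta> ^ v j) ^ Poly_Mapping.lookup p j = (\<beta> ^ v j) ^ Poly_Mapping.lookup q j"
            using fun_cong[OF eq, of "Poly_Mapping.single j 1"] by (simp only: single)
          then show ?thesis
            using power_eq_imp_mod_ord_eq[of "\<beta> ^ v j"] \<open>\<beta> \<noteq> 0\<close> assms(4) by (metis power_not_zero)
        qed
        then have rem_eq: "rem p = rem q"
          by (simp add: rem_def)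
        \<comment> \<open>The total degree is the weighted degree of the quotient plus the degree of
          the remainder. Homogeneity of \<open>f\<close> and equal remainders thus give equal
          weighted degrees.\<close>
        have "(\<Sum>i\<in>UNIV. d i * Poly_Mapping.lookup (quo u) i) + (\<Sum>i\<in>UNIV. Poly_Mapping.lookup (rem u) i) =
            (\<Sum>i\<in>UNIV. Poly_Mapping.lookup u i)" for u
          by (simp add: quo rem flip: sum.distrib)
        then have "(\<Sum>i\<in>UNIV. d i * Poly_Mapping.lookup (quo p) i) = (\<Sum>i\<in>UNIV. d i * Poly_Mapping.lookup (quo q) i)"
          by (metis add_right_cancel e keys rem_eq)
        then have "tmon (E (quo p)) - tmon (E (quo q)) \<in> ideal_gen H"
          by (intro image) (simp add: tmon_diff_mem_toric_ideal_iff)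
        then have "tmon (rem p) * (tmon (E (quo p)) - tmon (E (quo q))) \<in> ideal_gen H"
          by (rule ideal_gen_mult)
        moreover have "tmon (rem u) * tmon (E (quo u)) = (tmon u :: ('n, 'k) mpoly)" for u
          by (subst (3) split) (simp add: tmon_def mult_single)
        ultimately show "tmon p - tmon q \<in> ideal_gen H"
          by (simp add: right_diff_distrib rem_eq) (simp flip: rem_eq)
      qed
    qed
  qed
  moreover have "ideal_gen H \<subseteq> vanishing_ideal (degenerate_torus v :: ('k ^ 'n) set set)"
    unfolding vanishing_ideal_def
  proof (rule ideal_gen_subset, fold vanishing_ideal_def)
    show "H \<subseteq> vanishing_ideal (degenerate_torus v)"
    proof
      fix h assume "h \<in> H"
      then obtain i where i: "i \<in> {1..m}" and h: "h = tmon (E (a i)) - tmon (E (b i))"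
        by (auto simp: H_def)
      have "(tmon (a i) - tmon (b i) :: ('n, 'k) mpoly) \<in> toric_ideal d"
        unfolding toric using i by (intro ideal_gen_base) (auto simp: G_def)
      then show "h \<in> vanishing_ideal (degenerate_torus v)"
        unfolding h by (intro tmon_diff_mem_vanishing_ideal[OF E E root])
    qed
  qed
  ultimately show ?thesis
    by (simp add: H_def E_def)
qed

end
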